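(* Consider the parametric multi-agent persistent monitoring problem $\min_{\bm{\theta}\in\Theta,\,\mathbf{w}\ge 0} J(\bm{\theta},\mathbf{w})$ with $N$ agents and $M$ targets on $[0,L]$ over the horizon $[0,T]$, as described in the context. Consider the centralized gradient scheme $$[\bm{\theta}^{l+1},\mathbf{w}^{l+1}]^{\mathrm T}=[\bm{\theta}^{l},\mathbf{w}^{l}]^{\mathrm T}-[\alpha_\theta^l,\alpha_w^l]\,\nabla J(\bm{\theta}^l,\mathbf{w}^l),\qquad l=0,1,\ldots,$$ and the decentralized scheme in which each agent $j=1,\ldots,N$ updates only its own parameters, $$[\bm{\theta}_j^{l+1},\mathbf{w}_j^{l+1}]^{\mathrm T}=[\bm{\theta}_j^{l},\mathbf{w}_j^{l}]^{\mathrm T}-[\alpha_\theta^l,\alpha_w^l]\,\nabla_j J(\bar{\bm{\theta}},\bar{\mathbf{w}}),\qquad l=0,1,\ldots,$$ where $\nabla_jJ(\bar{\bm{\theta}},\bar{\mathbf{w}})$ is the gradient evaluated by agent $j$ at iteration $l$ using only the information listed below, collected while all agents follow the trajectories given by their current (iteration $l$) parameters. Suppose each agent $j$ is given: 1) its initial parameters $[\bm{\theta}_j^0,\mathbf{w}_j^0]$ (the $j$-th components of the initial parameters of the centralized scheme); 2) the local information set $I_j(t)$, $t\in[0,T]$; 3) the subset of the global information $\{\rho_i^0 : i\notin\mathcal{T}_j(t)\}$, $t\in[0,T]$, i.e. the occurrences of events $\rho_i^0$ ("$R_i$ hits $0$") for targets $i$ not in the target neighborhood of $j$ at the time of occurrence.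 Then any solution of the centralized scheme is recovered by the decentralized scheme: each agent $j$ can evaluate the gradients it needs from 1)-3), and for every $l\ge 0$ and every $j$ the decentralized iterate $[\bm{\theta}_j^l,\mathbf{w}_j^l]$ equals the $j$-th component of the centralized iterate $[\bm{\theta}^l,\mathbf{w}^l]$ (with the same step sizes).
   Context: **Agents and targets.** $N$ agents have positions $s_j(t)\in[0,L]$ with $\dot s_j(t)=u_j(t)$, $|u_j(t)|\le 1$; initial positions are given. There are $M$ targets at known fixed positions $x_i\in[0,L]$. Agent $j$ has sensing range $r_j>0$ and detects target $i$ with probability $p_{ij}(s_j)=\max\{0,1-|x_i-s_j|/r_j\}$. The derivative $\partial p_{ij}/\partial s_j$ takes values in $\{0,\pm 1/r_j\}$, is $0$ whenever $p_{ij}=0$, and has some fixed value of this set at the kink $s_j=x_i$. The joint detection probability of target $i$ is $P_i(\mathbf{s}(t))=1-\prod_{j=1}^N(1-p_{ij}(s_j(t)))$, $\mathbf{s}=[s_1,\ldots,s_N]^{\mathrm T}$. Target uncertainty $R_i(t)\ge 0$, with given $R_i(0)$, satisfies $\dot R_i(t)=0$ if $R_i(t)=0$ and $A_i\le B_iP_i(\mathbf{s}(t))$, and $\dot R_i(t)=A_i-B_iP_i(\mathbf{s}(t))$ otherwise, with constants $B_i>A_i>0$. **Parametric trajectories and cost.** Controls take values in $\{-1,0,1\}$. The trajectory of agent $j$ is determined by a finite vector of switching points $\bm{\theta}_j=[\theta_{j1},\ldots,\theta_{j\Gamma}]$, $\theta_{jl}\in[0,L]$, and a finite vector of dwell times $\mathbf{w}_j\ge0$: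 the agent moves at unit speed from $s_j(0)$ to $\theta_{j1}$, then to $\theta_{j2}$, etc.; at a switching point it either reverses direction immediately or stops ($u_j=0$) for the associated dwell time before moving on. $\bm{\theta}$ and $\mathbf{w}$ collect all $\bm{\theta}_j$, $\mathbf{w}_j$; $\Theta$ is the set of admissible switching points. The cost is $J(\bm{\theta},\mathbf{w})=\frac1T\int_0^T\sum_{i=1}^M R_i(t)\,dt$. **Neighborhoods.** $\mathcal{A}_j(t)=\{k\ne j:|s_k(t)-s_j(t)|\le r_c\}$ with communication range $r_c$; $\mathcal{T}_j(t)=\{i:|x_i-s_j(t)|\le r_j\}$ (target neighborhood of agent $j$); $\mathcal{B}_i(t)=\{j:|s_j(t)-x_i|\le r_j\}$ (agent neighborhood of target $i$); $\mathcal{N}_{ij}(t)=\mathcal{B}_i(t)\setminus\{j\}$. Agents are homogeneous with common range $r_j=r$, and $r_c\ge 2r$. **Events.** For all $i,j$: type I: $\rho_i^0$ ($R_i$ hits $0$, i.e. the dynamics of $R_i$ switch from $A_i-B_iP_i$ to $0$) and $\rho_i^+$ ($R_i$ leaves $0$, the dynamics switch back). Type II: $\pi_{ij}^0$ and $\pi_{ij}^+$ ($p_{ij}(s_j(t))$ hits, respectively leaves, $0$). Type III: $\nu_j^{(a,b)}$ ($u_j$ switches from $a$ to $b$, $a\neq b$ in $\{-1,0,1\}$). Type IV: $\Delta_{ij}^+$ and $\Delta_{ij}^-$ (an agent is added to, respectively removed from, $\mathcal{N}_{ij}$). There are finitely many events on $[0,T]$. $\mathcal{E}_j^A$ is the set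 of type III events of agent $j$; $\mathcal{E}_i^T$ is the set of type I, II, IV events related to target $i$. The local event set of agent $j$ is $\mathcal{E}_j(t)=\mathcal{E}_j^A\cup\bigcup_{i\in\mathcal{T}_j(t)}\mathcal{E}_i^T$, and its local information set is $I_j(t)=\mathcal{E}_j(t)\cup\bigcup_{i\in\mathcal{T}_j(t),\,k\in\mathcal{N}_{ij}(t)}\mathcal{E}_k(t)$. Being given an event set means knowing which of these events occur and when. In the limited information model, agent $j$ knows the model constants and its own parameters and trajectory, observes the state $R_i(t)$ of every target with $p_{ij}(s_j(t))>0$, and obtains by communication from its neighbors (those in $\mathcal N_{ij}(t)$, $i\in\mathcal T_j(t)$) their current positions and speeds and their observations of targets in their sensing range. All communication is without delay. **IPA gradients.** $\nabla_j$ denotes the derivative with respect to $(\bm{\theta}_j,\mathbf{w}_j)$. $\nabla_js_j(t)$ is the derivative of $s_j(t)$ (constant between type III events of agent $j$, right-continuous), and $\nabla_k s_j=0$ for $k\ne j$. The IPA derivative $\nabla_jR_i(t)$ is the right-continuous function with $\nabla_jR_i(0)=0$ such that between consecutive events $\frac{d}{dt}\nabla_jR_i(t)=0$ when $R_i(t)=0$ and $A_i\le B_iP_i(\mathbf{s}(t))$, and $$\frac{d}{dt}\nabla_jR_i(t)=-B_i\frac{\partial p_{ij}(s_j(t))}{\partial s_j}\,\nabla_js_j(t)\prod_{g\in\mathcal{N}_{ij}(t)}\bigl(1-p_{ig}(s_g(t))\bigr)$$ otherwise; at an event $\rho_i^0$ it is reset to $0$; at all other events it is continuous. The IPA gradient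 is $\nabla_jJ(\bm{\theta},\mathbf{w})=\frac1T\sum_{i=1}^M\int_0^T\nabla_jR_i(t)\,dt$, and $\nabla J=(\nabla_1J,\ldots,\nabla_NJ)$. **Gradient schemes.** $\alpha_\theta^l,\alpha_w^l$ are step sizes applied to the $\bm{\theta}$- and $\mathbf{w}$-components respectively, satisfying $\sum_l\alpha_\theta^l=\sum_l\alpha_w^l=\infty$ and $\alpha_\theta^l,\alpha_w^l\to0$. The iterates are assumed admissible, so that the trajectories and IPA gradients are well defined at each iteration. *)

theory Defs
  imports "HOL-Analysis.Analysis"
begin

text \<open>Agents are indexed by the finite type \<open>'n\<close>, targets by the finite type \<open>'m\<close>; so
  \<open>N = CARD('n)\<close> and \<open>M = CARD('m)\<close>.  Agents are homogeneous: \<open>sense_rad\<close> is the common \<open>r\<close>.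
  \<open>kink_slope i j\<close> is the value chosen for the derivative of \<open>p\<^sub>i\<^sub>j\<close> at \<open>s\<^sub>j = x\<^sub>i\<close>.\<close>

record ('n, 'm) model =
  mission_len :: real
  horizon :: real
  sense_rad :: real
  comm_rad :: real
  target_at :: "'m \<Rightarrow> real"
  growth :: "'m \<Rightarrow> real"
  decay :: "'m \<Rightarrow> real"
  kink_slope :: "'m \<Rightarrow> 'n \<Rightarrow> real"

definition valid_model :: "('n, 'm) model \<Rightarrow> bool" where
  "valid_model M \<longleftrightarrow>
     0 < mission_len M \<and> 0 < horizon M \<and> 0 < sense_rad M \<and> 2 * sense_rad M \<le> comm_rad M \<and>
     (\<forall>i. target_at M i \<in> {0..mission_len M}) \<and>
     (\<forall>i. 0 < growth M i \<and> growth M i < decay M i) \<and>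
     (\<forall>i j. kink_slope M i j \<in> {0, 1 / sense_rad M, - (1 / sense_rad M)})"

definition valid_init :: "('n, 'm) model \<Rightarrow> ('n \<Rightarrow> real) \<Rightarrow> ('m \<Rightarrow> real) \<Rightarrow> bool" where
  "valid_init M s0 R0 \<longleftrightarrow> (\<forall>j. s0 j \<in> {0..mission_len M}) \<and> (\<forall>i. 0 \<le> R0 i)"

definition detect :: "('n, 'm) model \<Rightarrow> 'm \<Rightarrow> real \<Rightarrow> real" where
  "detect M i y = max 0 (1 - \<bar>target_at M i - y\<bar> / sense_rad M)"

definition detect_slope :: "('n, 'm) model \<Rightarrow> 'm \<Rightarrow> 'n \<Rightarrow> real \<Rightarrow> real" where
  "detect_slope M i j y =
     (if detect M i y = 0 then 0
      else if y < target_at M i then 1 / sense_rad M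
      else if y > target_at M i then - (1 / sense_rad M)
      else kink_slope M i j)"

text \<open>The layout of an agent is a list with one entry per switching point, saying whether a dwell
  time is associated with that point.  Where there is none, the agent never stops.  The parameter
  vector of an agent is a function of which only the values on \<open>coords\<close> of the layout matter.\<close>

datatype coord = Switch nat | Dwell nat

type_synonym layout = "bool list"
type_synonym params = "coord \<Rightarrow> real"

definition coords :: "layout \<Rightarrow> coord set" where
  "coords ds = {Switch k | k. k < length ds} \<union> {Dwell k | k. k < length ds \<and> ds ! k}"

fun feasible_values :: "('n, 'm) model \<Rightarrow> coord \<Rightarrow> real set" where
  "feasible_values M (Switch k) = {0..mission_len M}"
| "feasible_values M (Dwell k) = {0..}"

definition plan :: "layout \<Rightarrow> params \<Rightarrow> (real \<times> real) list" where
  "plan ds v = map (\<lambda>k. (v (Switch k), if ds ! k then v (Dwell k) else 0)) [0..<length ds]"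

text \<open>Position and (right-continuous) control after time \<open>t\<close> of an agent that starts at \<open>y\<close> and
  follows a list of pairs (switching point, dwell time).  Once the list is exhausted it rests.\<close>

fun position :: "real \<Rightarrow> (real \<times> real) list \<Rightarrow> real \<Rightarrow> real" where
  "position y [] t = y"
| "position y ((\<theta>, w) # ps) t =
     (if t < \<bar>\<theta> - y\<bar> then y + sgn (\<theta> - y) * t
      else if t < \<bar>\<theta> - y\<bar> + w then \<theta>
      else position \<theta> ps (t - \<bar>\<theta> - y\<bar> - w))"

fun control :: "real \<Rightarrow> (real \<times> real) list \<Rightarrow> real \<Rightarrow> real" where
  "control y [] t = 0"
| "control y ((\<theta>, w) # ps) t =
     (if t < \<bar>\<theta> - y\<bar> then sgn (\<theta> - y)
      else if t < \<bar>\<theta> - y\<bar> + w then 0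
      else control \<theta> ps (t - \<bar>\<theta> - y\<bar> - w))"

record ('n, 'm) run =
  pos :: "'n \<Rightarrow> real \<Rightarrow> real"
  ctrl :: "'n \<Rightarrow> real \<Rightarrow> real"
  unc :: "'m \<Rightarrow> real \<Rightarrow> real"

definition joint_detect :: "('n::finite, 'm) model \<Rightarrow> ('n, 'm) run \<Rightarrow> 'm \<Rightarrow> real \<Rightarrow> real" where
  "joint_detect M h i t = 1 - (\<Prod>j\<in>UNIV. 1 - detect M i (pos h j t))"

definition idle :: "('n::finite, 'm) model \<Rightarrow> ('n, 'm) run \<Rightarrow> 'm \<Rightarrow> real \<Rightarrow> bool" where
  "idle M h i t \<longleftrightarrow> unc h i t = 0 \<and> growth M i \<le> decay M i * joint_detect M h i t"

text \<open>The derivative of \<open>R\<^sub>i\<close> is the right one: at the instant at which \<open>R\<^sub>i\<close> hits \<open>0\<close>, and at which the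
  prescribed value becomes \<open>0\<close>, the left derivative may be negative.\<close>

definition uncertainty_dynamics ::
  "('n::finite, 'm) model \<Rightarrow> ('m \<Rightarrow> real) \<Rightarrow> ('n, 'm) run \<Rightarrow> bool" where
  "uncertainty_dynamics M R0 h \<longleftrightarrow>
     (\<forall>i. unc h i 0 = R0 i \<and>
          continuous_on {0..horizon M} (unc h i) \<and>
          (\<forall>t\<in>{0..horizon M}. 0 \<le> unc h i t) \<and>
          (\<forall>t\<in>{0..<horizon M}.
             (unc h i has_real_derivative
                (if idle M h i t then 0 else growth M i - decay M i * joint_detect M h i t))
             (at_right t)))"

definition generated_run ::
  "('n::finite, 'm) model \<Rightarrow> ('n \<Rightarrow> layout) \<Rightarrow> ('n \<Rightarrow> real) \<Rightarrow> ('m \<Rightarrow> real) \<Rightarrow>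
   ('n \<Rightarrow> params) \<Rightarrow> ('n, 'm) run \<Rightarrow> bool" where
  "generated_run M lay s0 R0 v h \<longleftrightarrow>
     (\<forall>j. pos h j = position (s0 j) (plan (lay j) (v j)) \<and>
          ctrl h j = control (s0 j) (plan (lay j) (v j))) \<and>
     uncertainty_dynamics M R0 h"

definition comm_nbhd :: "('n, 'm) model \<Rightarrow> ('n, 'm) run \<Rightarrow> 'n \<Rightarrow> real \<Rightarrow> 'n set" where
  "comm_nbhd M h j t = {k. k \<noteq> j \<and> \<bar>pos h k t - pos h j t\<bar> \<le> comm_rad M}"

definition target_nbhd :: "('n, 'm) model \<Rightarrow> ('n, 'm) run \<Rightarrow> 'n \<Rightarrow> real \<Rightarrow> 'm set" where
  "target_nbhd M h j t = {i. \<bar>target_at M i - pos h j t\<bar> \<le> sense_rad M}"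

definition agent_nbhd :: "('n, 'm) model \<Rightarrow> ('n, 'm) run \<Rightarrow> 'm \<Rightarrow> real \<Rightarrow> 'n set" where
  "agent_nbhd M h i t = {j. \<bar>pos h j t - target_at M i\<bar> \<le> sense_rad M}"

definition co_observers :: "('n, 'm) model \<Rightarrow> ('n, 'm) run \<Rightarrow> 'm \<Rightarrow> 'n \<Rightarrow> real \<Rightarrow> 'n set" where
  "co_observers M h i j t = agent_nbhd M h i t - {j}"

datatype ('n, 'm) event =
    Rho0 'm            \<comment> \<open>type I: \<open>R\<^sub>i\<close> hits \<open>0\<close>\<close>
  | RhoPlus 'm         \<comment> \<open>type I: \<open>R\<^sub>i\<close> leaves \<open>0\<close>\<close>
  | Pi0 'm 'n          \<comment> \<open>type II: \<open>p\<^sub>i\<^sub>j\<close> hits \<open>0\<close>\<close>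
  | PiPlus 'm 'n       \<comment> \<open>type II: \<open>p\<^sub>i\<^sub>j\<close> leaves \<open>0\<close>\<close>
  | Nu 'n real real    \<comment> \<open>type III: \<open>u\<^sub>j\<close> switches\<close>
  | DeltaPlus 'm 'n    \<comment> \<open>type IV: an agent joins the co-observers of target \<open>i\<close> and agent \<open>j\<close>\<close>
  | DeltaMinus 'm 'n   \<comment> \<open>type IV: an agent leaves them\<close>

text \<open>The regimes \<open>idle\<close>, \<open>p\<^sub>i\<^sub>j = 0\<close> and membership in \<open>co_observers\<close> all hold on closed sets of
  times.  Hence an event that enters such a regime occurs at the first instant of the regime, and
  one that leaves it at the last instant.\<close>

fun occurs :: "('n::finite, 'm) model \<Rightarrow> ('n, 'm) run \<Rightarrow> ('n, 'm) event \<Rightarrow> real \<Rightarrow> bool" where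
  "occurs M h (Rho0 i) t \<longleftrightarrow>
     0 < t \<and> t \<le> horizon M \<and> idle M h i t \<and> (\<forall>\<^sub>F \<tau> in at_left t. \<not> idle M h i \<tau>)"
| "occurs M h (RhoPlus i) t \<longleftrightarrow>
     0 \<le> t \<and> t < horizon M \<and> idle M h i t \<and> (\<forall>\<^sub>F \<tau> in at_right t. \<not> idle M h i \<tau>)"
| "occurs M h (Pi0 i j) t \<longleftrightarrow>
     0 < t \<and> t \<le> horizon M \<and> detect M i (pos h j t) = 0 \<and>
     (\<forall>\<^sub>F \<tau> in at_left t. detect M i (pos h j \<tau>) > 0)"
| "occurs M h (PiPlus i j) t \<longleftrightarrow>
     0 \<le> t \<and> t < horizon M \<and> detect M i (pos h j t) = 0 \<and>
     (\<forall>\<^sub>F \<tau> in at_right t. detect M i (pos h j \<tau>) > 0)"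
| "occurs M h (Nu j a b) t \<longleftrightarrow>
     0 < t \<and> t \<le> horizon M \<and> a \<noteq> b \<and> (\<forall>\<^sub>F \<tau> in at_left t. ctrl h j \<tau> = a) \<and> ctrl h j t = b"
| "occurs M h (DeltaPlus i j) t \<longleftrightarrow>
     0 < t \<and> t \<le> horizon M \<and>
     (\<exists>k. k \<in> co_observers M h i j t \<and> (\<forall>\<^sub>F \<tau> in at_left t. k \<notin> co_observers M h i j \<tau>))"
| "occurs M h (DeltaMinus i j) t \<longleftrightarrow>
     0 \<le> t \<and> t < horizon M \<and>
     (\<exists>k. k \<in> co_observers M h i j t \<and> (\<forall>\<^sub>F \<tau> in at_right t. k \<notin> co_observers M h i j \<tau>))"

definition event_times :: "('n::finite, 'm) model \<Rightarrow> ('n, 'm) run \<Rightarrow> real set" where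
  "event_times M h = {t. \<exists>e. occurs M h e t}"

definition agent_events :: "'n \<Rightarrow> ('n, 'm) event set" where
  "agent_events j = {Nu j a b | a b. a \<in> {-1, 0, 1} \<and> b \<in> {-1, 0, 1} \<and> a \<noteq> b}"

definition target_events :: "'m \<Rightarrow> ('n, 'm) event set" where
  "target_events i = {Rho0 i, RhoPlus i} \<union>
     (\<Union>j. {Pi0 i j, PiPlus i j, DeltaPlus i j, DeltaMinus i j})"

definition local_events ::
  "('n, 'm) model \<Rightarrow> ('n, 'm) run \<Rightarrow> 'n \<Rightarrow> real \<Rightarrow> ('n, 'm) event set" where
  "local_events M h j t = agent_events j \<union> (\<Union>i\<in>target_nbhd M h j t. target_events i)"

definition local_info ::
  "('n, 'm) model \<Rightarrow> ('n, 'm) run \<Rightarrow> 'n \<Rightarrow> real \<Rightarrow> ('n, 'm) event set" where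
  "local_info M h j t = local_events M h j t \<union>
     (\<Union>i\<in>target_nbhd M h j t. \<Union>k\<in>co_observers M h i j t. local_events M h k t)"

definition observation :: "('n, 'm) model \<Rightarrow> ('n, 'm) run \<Rightarrow> 'n \<Rightarrow> real \<Rightarrow> 'm \<Rightarrow> real option" where
  "observation M h j t =
     (\<lambda>i. if detect M i (pos h j t) > 0 then Some (unc h i t) else None)"

text \<open>Since \<open>2 * sense_rad M \<le> comm_rad M\<close>, the intersection with \<open>comm_nbhd\<close> removes nothing.\<close>

definition partners :: "('n, 'm) model \<Rightarrow> ('n, 'm) run \<Rightarrow> 'n \<Rightarrow> real \<Rightarrow> 'n set" where
  "partners M h j t =
     comm_nbhd M h j t \<inter> (\<Union>i\<in>target_nbhd M h j t. co_observers M h i j t)"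

definition during :: "('n, 'm) model \<Rightarrow> (real \<Rightarrow> 'a) \<Rightarrow> real \<Rightarrow> 'a option" where
  "during M f = (\<lambda>t. if t \<in> {0..horizon M} then Some (f t) else None)"

record ('n, 'm) info =
  own_layout :: layout
  own_plan :: "(real \<times> real) list"
  own_traj :: "real \<Rightarrow> real option"
  known_events :: "(real \<times> ('n, 'm) event) set"
  remote_hits :: "(real \<times> ('n, 'm) event) set"
  own_obs :: "real \<Rightarrow> ('m \<Rightarrow> real option) option"
  received :: "real \<Rightarrow> ('n \<Rightarrow> (real \<times> real \<times> ('m \<Rightarrow> real option)) option) option"

definition info_of ::
  "('n::finite, 'm) model \<Rightarrow> ('n \<Rightarrow> layout) \<Rightarrow> ('n \<Rightarrow> params) \<Rightarrow> ('n, 'm) run \<Rightarrow> 'n \<Rightarrow>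
   ('n, 'm) info" where
  "info_of M lay v h j =
     \<lparr> own_layout = lay j,
       own_plan = plan (lay j) (v j),
       own_traj = during M (pos h j),
       known_events =
         {(t, e). t \<in> {0..horizon M} \<and> e \<in> local_info M h j t \<and> occurs M h e t},
       remote_hits =
         {(t, Rho0 i) | t i. t \<in> {0..horizon M} \<and> i \<notin> target_nbhd M h j t \<and> occurs M h (Rho0 i) t},
       own_obs = during M (observation M h j),
       received = during M (\<lambda>t k.
         if k \<in> partners M h j t then Some (pos h k t, ctrl h k t, observation M h k t)
         else None) \<rparr>"

text \<open>\<open>position_gradient M ds y v h j D\<close>: \<open>D c\<close> is the partial derivative of the trajectory of agent
  \<open>j\<close> (layout \<open>ds\<close>, start \<open>y\<close>, parameters \<open>v\<close>) with respect to coordinate \<open>c\<close>; on the boundary of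
  the feasible range of \<open>c\<close> it is one-sided.\<close>

definition position_gradient ::
  "('n::finite, 'm) model \<Rightarrow> layout \<Rightarrow> real \<Rightarrow> params \<Rightarrow> ('n, 'm) run \<Rightarrow> 'n \<Rightarrow>
   (coord \<Rightarrow> real \<Rightarrow> real) \<Rightarrow> bool" where
  "position_gradient M ds y v h j D \<longleftrightarrow>
     (\<forall>c\<in>coords ds.
        (\<forall>t\<in>{0<..<horizon M}. (\<forall>a b. \<not> occurs M h (Nu j a b) t) \<longrightarrow>
           ((\<lambda>z. position y (plan ds (v(c := z))) t) has_real_derivative D c t)
             (at (v c) within feasible_values M c)) \<and>
        (\<forall>t1 t2. 0 \<le> t1 \<and> t1 < t2 \<and> t2 < horizon M \<and>
           (\<forall>t\<in>{t1<..t2}. \<forall>a b. \<not> occurs M h (Nu j a b) t) \<longrightarrow> D c t1 = D c t2) \<and>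
        (\<forall>t\<in>{0..<horizon M}. continuous (at_right t) (D c)))"

text \<open>\<open>uncertainty_gradient M h j i ds dR\<close>: given one component \<open>ds\<close> of the gradient of \<open>s\<^sub>j\<close>, \<open>dR\<close> is
  the corresponding component of the IPA derivative of \<open>R\<^sub>i\<close>.  The finite set \<open>K\<close> accounts for
  instants at which \<open>s\<^sub>j\<close> passes over \<open>x\<^sub>i\<close>: these are not events, but the slope of \<open>p\<^sub>i\<^sub>j\<close> jumps there,
  so that \<open>dR\<close> is continuous but not differentiable.\<close>

definition uncertainty_gradient ::
  "('n::finite, 'm) model \<Rightarrow> ('n, 'm) run \<Rightarrow> 'n \<Rightarrow> 'm \<Rightarrow> (real \<Rightarrow> real) \<Rightarrow> (real \<Rightarrow> real) \<Rightarrow> bool" where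
  "uncertainty_gradient M h j i ds dR \<longleftrightarrow>
     dR 0 = 0 \<and>
     (\<exists>K. finite K \<and>
        (\<forall>t\<in>{0<..<horizon M} - event_times M h - K.
           (dR has_real_derivative
              (if idle M h i t then 0
               else - decay M i * detect_slope M i j (pos h j t) * ds t *
                    (\<Prod>g\<in>co_observers M h i j t. 1 - detect M i (pos h g t))))
           (at t))) \<and>
     (\<forall>t\<in>{0..<horizon M}. continuous (at_right t) dR) \<and>
     (\<forall>t\<in>{0<..horizon M}. if occurs M h (Rho0 i) t then dR t = 0 else continuous (at_left t) dR)"

text \<open>\<open>ipa_gradient M ds y v h j g\<close>: the values of \<open>g\<close> on \<open>coords ds\<close> are the IPA gradient of the cost
  with respect to the parameters of agent \<open>j\<close>, in the run \<open>h\<close>.\<close>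

definition ipa_gradient ::
  "('n::finite, 'm::finite) model \<Rightarrow> layout \<Rightarrow> real \<Rightarrow> params \<Rightarrow> ('n, 'm) run \<Rightarrow> 'n \<Rightarrow>
   (coord \<Rightarrow> real) \<Rightarrow> bool" where
  "ipa_gradient M ds y v h j g \<longleftrightarrow>
     (\<exists>D dR. position_gradient M ds y v h j D \<and>
        (\<forall>c\<in>coords ds.
           (\<forall>i. uncertainty_gradient M h j i (D c) (dR i c)) \<and>
           g c = 1 / horizon M * (\<Sum>i\<in>UNIV. integral {0..horizon M} (dR i c))))"

definition step_sizes :: "(nat \<Rightarrow> real) \<Rightarrow> bool" where
  "step_sizes \<alpha> \<longleftrightarrow> filterlim (\<lambda>n. \<Sum>l<n. \<alpha> l) at_top sequentially \<and> \<alpha> \<longlonglongrightarrow> 0"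

fun step :: "(nat \<Rightarrow> real) \<Rightarrow> (nat \<Rightarrow> real) \<Rightarrow> nat \<Rightarrow> coord \<Rightarrow> real" where
  "step \<alpha>\<theta> \<alpha>w l (Switch k) = \<alpha>\<theta> l"
| "step \<alpha>\<theta> \<alpha>w l (Dwell k) = \<alpha>w l"

definition admissible_run ::
  "('n::finite, 'm) model \<Rightarrow> ('n \<Rightarrow> layout) \<Rightarrow> ('n \<Rightarrow> real) \<Rightarrow> ('m \<Rightarrow> real) \<Rightarrow>
   ('n \<Rightarrow> params) \<Rightarrow> ('n, 'm) run \<Rightarrow> bool" where
  "admissible_run M lay s0 R0 v h \<longleftrightarrow>
     (\<forall>j. \<forall>c\<in>coords (lay j). v j c \<in> feasible_values M c) \<and>
     generated_run M lay s0 R0 v h \<and>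
     finite (event_times M h)"

text \<open>\<open>v l j\<close> are the parameters of agent \<open>j\<close> at iteration \<open>l\<close>, and \<open>h l\<close> is the run at iteration \<open>l\<close>.\<close>

definition centralized_solution ::
  "('n::finite, 'm::finite) model \<Rightarrow> ('n \<Rightarrow> layout) \<Rightarrow> ('n \<Rightarrow> real) \<Rightarrow> ('m \<Rightarrow> real) \<Rightarrow>
   (nat \<Rightarrow> real) \<Rightarrow> (nat \<Rightarrow> real) \<Rightarrow>
   (nat \<Rightarrow> 'n \<Rightarrow> params) \<Rightarrow> (nat \<Rightarrow> ('n, 'm) run) \<Rightarrow> bool" where
  "centralized_solution M lay s0 R0 \<alpha>\<theta> \<alpha>w v h \<longleftrightarrow>
     (\<forall>l. admissible_run M lay s0 R0 (v l) (h l) \<and>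
       (\<exists>grad. \<forall>j.
          ipa_gradient M (lay j) (s0 j) (v l j) (h l) j (grad j) \<and>
          (\<forall>c\<in>coords (lay j). v (Suc l) j c = v l j c - step \<alpha>\<theta> \<alpha>w l c * grad j c)))"

text \<open>\<open>G j\<close> is the rule by which agent \<open>j\<close> evaluates a gradient from the information it has collected
  in the current run; \<open>v0\<close> are the initial parameters.\<close>

definition decentralized_solution ::
  "('n::finite, 'm::finite) model \<Rightarrow> ('n \<Rightarrow> ('n, 'm) info \<Rightarrow> coord \<Rightarrow> real) \<Rightarrow>
   ('n \<Rightarrow> layout) \<Rightarrow> ('n \<Rightarrow> real) \<Rightarrow> ('m \<Rightarrow> real) \<Rightarrow> (nat \<Rightarrow> real) \<Rightarrow> (nat \<Rightarrow> real) \<Rightarrow>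
   ('n \<Rightarrow> params) \<Rightarrow> (nat \<Rightarrow> 'n \<Rightarrow> params) \<Rightarrow> (nat \<Rightarrow> ('n, 'm) run) \<Rightarrow> bool" where
  "decentralized_solution M G lay s0 R0 \<alpha>\<theta> \<alpha>w v0 v h \<longleftrightarrow>
     (\<forall>j. \<forall>c\<in>coords (lay j). v 0 j c = v0 j c) \<and>
     (\<forall>l. generated_run M lay s0 R0 (v l) (h l) \<and>
       (\<forall>j. \<forall>c\<in>coords (lay j).
          v (Suc l) j c = v l j c - step \<alpha>\<theta> \<alpha>w l c * G j (info_of M lay (v l) (h l) j) c))"

end

theory Submission
  imports Defs
begin

text \<open>A rule for agent \<open>j\<close> exists as soon as two runs with the same information for \<open>j\<close> have the same
  IPA gradients.  The slope of \<open>p\<^sub>i\<^sub>j\<close> vanishes while \<open>j\<close> does not detect target \<open>i\<close>, so then \<open>\<nabla>\<^sub>jR\<^sub>i\<close> is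
  locally constant whatever the other agents do.  While \<open>j\<close> detects \<open>i\<close>, it observes \<open>R\<^sub>i\<close> and, as
  \<open>r\<^sub>c \<ge> 2r\<close>, hears from all co-observers, which are the only other agents that affect \<open>P\<^sub>i\<close>.  Hence
  \<open>j\<close> knows the derivative of \<open>\<nabla>\<^sub>jR\<^sub>i\<close> at all but finitely many instants, and it knows all the resets.
  Besides, the parameters determine the run, because the squared difference of two solutions of the
  uncertainty dynamics is nonincreasing.\<close>

section \<open>Real induction and functions controlled by one-sided derivatives\<close>

text \<open>At the infimum of the counterexamples \<open>P\<close> holds, by \<open>base\<close> or
  \<open>left\<close>; \<open>right\<close> then pushes \<open>P\<close> past the infimum.
  Properties known only through one-sided limits are propagated along the horizon in this
  way.\<close>

lemma real_interval_induct [consumes 1, case_names base left right]: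
  fixes a b t :: real
  assumes "t \<in> {a..b}"
    and base: "P a"
    and left: "\<And>t. a < t \<Longrightarrow> t \<le> b \<Longrightarrow> \<forall>s\<in>{a..<t}. P s \<Longrightarrow> P t"
    and right: "\<And>t. a \<le> t \<Longrightarrow> t < b \<Longrightarrow> P t \<Longrightarrow> \<forall>\<^sub>F s in at_right t. P s"
  shows "P t"
proof (rule ccontr)
  assume "\<not> P t"
  define S where "S = {s \<in> {a..b}. \<not> P s}"
  define m where "m = Inf S"
  have tS: "t \<in> S" using \<open>\<not> P t\<close> assms(1) by (simp add: S_def)
  have bdd: "bdd_below S" by (rule bdd_belowI[of _ a]) (simp add: S_def)
  have m_le: "m \<le> s" if "s \<in> S" for s
    unfolding m_def using that bdd by (rule cInf_lower)
  have am: "a \<le> m" unfolding m_def by (rule cInf_greatest) (use tS in \<open>auto simp: S_def\<close>)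
  have mb: "m \<le> b" using m_le[OF tS] assms(1) by simp
  have below: "\<forall>s\<in>{a..<m}. P s" using m_le mb by (force simp: S_def)
  have Pm: "P m" using base left[of m] below am mb by (cases "a = m") auto
  have "t \<noteq> m" using Pm \<open>\<not> P t\<close> by auto
  then have "m < b" using m_le[OF tS] assms(1) by simp
  from right[OF am this Pm] obtain e where e: "m < e" "\<And>s. m < s \<Longrightarrow> s < e \<Longrightarrow> P s"
    unfolding eventually_at_right_field by blast
  have "e \<le> m" unfolding m_def
  proof (rule cInf_greatest)
    show "e \<le> s" if "s \<in> S" for s
    proof (rule ccontr)
      assume "\<not> e \<le> s"
      moreover have "m < s" using m_le[OF that] Pm that by (cases "s = m") (auto simp: S_def)
      ultimately show False using e(2)[of s] that by (simp add: S_def)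
    qed
  qed (use tS in auto)
  then show False using e(1) by simp
qed

text \<open>With right derivatives only, the mean value theorem does not apply. Tilting
  \<open>f\<close> by a small negative slope makes its right derivative strictly negative, which
  gives the step to the right; continuity gives the step from the left.\<close>

lemma nonincreasing_of_right_derivative:
  fixes f :: "real \<Rightarrow> real"
  assumes cont: "continuous_on {a..b} f"
    and deriv: "\<And>t. a \<le> t \<Longrightarrow> t < b \<Longrightarrow> \<exists>d\<le>0. (f has_real_derivative d) (at_right t)"
    and t: "t \<in> {a..b}"
  shows "f t \<le> f a"
proof -
  have "f t - \<epsilon> * (t - a) \<le> f a" if "0 < \<epsilon>" for \<epsilon>
    using t
  proof (induction rule: real_interval_induct)
    case base
    then show ?case by simp
  next
    case (left t)
    have "continuous_on {a..t} (\<lambda>s. f s - \<epsilon> * (s - a))"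
      using left(1,2) by (intro continuous_intros continuous_on_subset[OF cont]) auto
    then have lim: "((\<lambda>s. f s - \<epsilon> * (s - a)) \<longlongrightarrow> f t - \<epsilon> * (t - a)) (at_left t)"
      using left(1) by (rule continuous_on_Icc_at_leftD)
    have "\<forall>\<^sub>F s in at_left t. f s - \<epsilon> * (s - a) \<le> f a"
      unfolding eventually_at_left_field using left(1,3) by (intro exI[of _ a]) auto
    then show ?case using lim by (intro tendsto_upperbound) auto
  next
    case (right t)
    obtain d where d: "d \<le> 0" "(f has_real_derivative d) (at_right t)"
      using deriv right(1,2) by blast
    have "((\<lambda>s. f s - \<epsilon> * (s - a)) has_real_derivative d - \<epsilon>) (at_right t)"
      using d(2) by (auto intro!: derivative_eq_intros)
    \<comment> \<open>The tilt is needed here: \<open>d\<close> may be 0, but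
      \<open>d - \<epsilon>\<close> is strictly negative, so the tilted function decreases just
      after \<open>t\<close>.\<close>
    from has_real_derivative_neg_dec_right[OF this] d(1) that obtain e
      where e: "0 < e" "\<And>h. 0 < h \<Longrightarrow> h < e \<Longrightarrow> f (t + h) - \<epsilon> * (t + h - a) < f t - \<epsilon> * (t - a)"
      by auto
    have "f s - \<epsilon> * (s - a) \<le> f a" if "t < s" "s < t + e" for s
      using e(2)[of "s - t"] that right(3) by simp
    then show ?case unfolding eventually_at_right_field
      using e(1) by (intro exI[of _ "t + e"]) auto
  qed
  note * = this
  show ?thesis
  proof (cases "t = a")
    case False
    then have pos: "0 < t - a" using t by simp
    show ?thesis
    proof (rule field_le_epsilon)
      fix e :: real assume "0 < e"
      \<comment> \<open>This tilt costs exactly \<open>e\<close> at time \<open>t\<close>.\<close>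
      then have "f t - e / (t - a) * (t - a) \<le> f a" using pos by (intro *) simp
      then show "f t \<le> f a + e" using pos by simp
    qed
  qed simp
qed

lemma eventually_at_right_notin_finite:
  fixes t :: real
  assumes "finite S"
  shows "\<forall>\<^sub>F s in at_right t. s \<notin> S"
proof (rule filter_leD)
  show "at_right t \<le> at t" by (rule at_le) simp
  show "\<forall>\<^sub>F s in at t. s \<notin> S"
    using islimpt_finite[OF assms] by (simp add: islimpt_iff_eventually)
qed

text \<open>The alternative in \<open>left_cont\<close> accommodates resets: the value is either 0
  outright or inherited from the left. Finiteness of \<open>S\<close> leaves a gap after each
  \<open>t\<close>, on which \<open>f\<close> is constant, and right continuity ties this constant
  to \<open>f t\<close>.\<close>

lemma zero_of_piecewise_constant:
  fixes f :: "real \<Rightarrow> real"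
  assumes "finite S" and "f a = 0"
    and deriv: "\<And>t. t \<in> {a<..<b} - S \<Longrightarrow> (f has_real_derivative 0) (at t)"
    and right_cont: "\<And>t. t \<in> {a..<b} \<Longrightarrow> continuous (at_right t) f"
    and left_cont: "\<And>t. t \<in> {a<..b} \<Longrightarrow> f t = 0 \<or> continuous (at_left t) f"
    and t: "t \<in> {a..b}"
  shows "f t = 0"
  using t
proof (induction rule: real_interval_induct)
  case base
  then show ?case by fact
next
  case (left t)
  show ?case
  proof (cases "f t = 0")
    case False
    then have lim: "(f \<longlongrightarrow> f t) (at_left t)"
      using left_cont[of t] left(1,2) by (simp add: continuous_within)
    have "\<forall>\<^sub>F s in at_left t. f s = 0"
      unfolding eventually_at_left_field using left(1,3) by (intro exI[of _ a]) auto
    then have "(f \<longlongrightarrow> 0) (at_left t)" by (rule tendsto_eventually)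
    then show ?thesis using lim tendsto_unique trivial_limit_at_left_real by blast
  qed
next
  case (right t)
  have "\<forall>\<^sub>F s in at_right t. s \<notin> S"
    using assms(1) by (rule eventually_at_right_notin_finite)
  then obtain e where e: "t < e" "\<And>s. t < s \<Longrightarrow> s < e \<Longrightarrow> s \<notin> S"
    unfolding eventually_at_right_field by blast
  have "f s = 0" if s: "t < s" "s < min e b" for s
  proof -
    have d: "(f has_real_derivative 0) (at x)" if "t < x" "x \<le> s" for x
      using that s e(2)[of x] right(1) by (intro deriv) auto
    have "continuous_on {t..s} f"
      unfolding continuous_on_eq_continuous_within
    proof
      fix x assume x: "x \<in> {t..s}"
      show "continuous (at x within {t..s}) f"
      proof (cases "x = t")
        case True
        then show ?thesis using right_cont[of t] right(1,2) s(1) by (simp add: at_within_Icc_at_right)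
      next
        case False
        then have "isCont f x" using x by (intro DERIV_isCont[OF d]) auto
        then show ?thesis by (rule continuous_at_imp_continuous_at_within)
      qed
    qed
    then have "f s = f t"
      using s(1) d by (intro DERIV_isconst_end) auto
    then show ?thesis using right(3) by simp
  qed
  then show ?case unfolding eventually_at_right_field
    using e(1) right(2) by (intro exI[of _ "min e b"]) auto
qed

lemma has_real_derivative_unique_within:
  fixes f :: "real \<Rightarrow> real"
  assumes "(f has_real_derivative a) (at x within S)" "(f has_real_derivative b) (at x within S)"
    and "at x within S \<noteq> bot"
  shows "a = b"
  using assms tendsto_unique unfolding has_field_derivative_iff by blast

text \<open>The feasible range contains a nondegenerate interval through \<open>y\<close>, so a
  partial derivative is unique even where it is one-sided.\<close>

lemma feasible_values_at_within:
  assumes "valid_model M" "y \<in> feasible_values M c"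
  shows "at y within feasible_values M c \<noteq> bot"
proof -
  obtain b where b: "0 < b" "y \<in> {0..b}" "{0..b} \<subseteq> feasible_values M c"
  proof (cases c)
    case (Switch k)
    then show ?thesis using that[of "mission_len M"] assms by (auto simp: valid_model_def)
  next
    case (Dwell k)
    then show ?thesis using that[of "y + 1"] assms by auto
  qed
  have "y islimpt {0..b}"
    using b islimpt_Icc[of 0 b y] by simp
  then show ?thesis using b(3) islimpt_subset trivial_limit_within by metis
qed

section \<open>Dependence of the gradient on the parameters and on the run\<close>

lemma plan_cong:
  assumes "\<And>c. c \<in> coords ds \<Longrightarrow> v c = v' c"
  shows "plan ds v = plan ds v'"
  using assms by (auto simp: plan_def coords_def)

lemma plan_eqD:
  assumes "plan ds v = plan ds v'" "c \<in> coords ds"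
  shows "v c = v' c"
  using assms by (force simp: plan_def coords_def)

text \<open>Serves to read the initial position, which is not a field of \<open>info\<close>, off
  the trajectory. Nonnegative dwell times matter: after a trivial move, a negative one would shift
  the rest of the plan to a positive time.\<close>

lemma position_0:
  assumes "\<And>p. p \<in> set ps \<Longrightarrow> 0 \<le> snd p"
  shows "position y ps 0 = y"
  using assms
proof (induction ps arbitrary: y)
  case (Cons p ps)
  obtain \<theta> w where p: "p = (\<theta>, w)" by (cases p)
  then have "0 \<le> w" using Cons.prems[of p] by simp
  moreover have "position \<theta> ps 0 = \<theta>" using Cons.prems by (intro Cons.IH) auto
  ultimately show ?case using p by (cases "w = 0") auto
qed simp

lemma position_plan_0:
  assumes "\<And>c. c \<in> coords ds \<Longrightarrow> v c \<in> feasible_values M c"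
  shows "position y (plan ds v) 0 = y"
proof (rule position_0)
  fix p assume "p \<in> set (plan ds v)"
  then obtain k where k: "k < length ds" "p = (v (Switch k), if ds ! k then v (Dwell k) else 0)"
    by (auto simp: plan_def)
  show "0 \<le> snd p" using k assms[of "Dwell k"] by (auto simp: coords_def)
qed

lemma unc_unique:
  assumes "uncertainty_dynamics M R0 h" "uncertainty_dynamics M R0 h'"
    and "pos h = pos h'" "t \<in> {0..horizon M}"
  shows "unc h i t = unc h' i t"
proof -
  define f where "f t = (unc h i t - unc h' i t)\<^sup>2" for t
  have jd: "joint_detect M h' i t = joint_detect M h i t" for i t
    using assms(3) by (simp add: joint_detect_def)
  have "f t \<le> f 0"
  proof (rule nonincreasing_of_right_derivative[where f = f and b = "horizon M"])
    show "continuous_on {0..horizon M} f"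
      unfolding f_def using assms(1,2)
      by (intro continuous_intros) (auto simp: uncertainty_dynamics_def)
  next
    fix t assume t: "0 \<le> t" "t < horizon M"
    let ?q = "growth M i - decay M i * joint_detect M h i t"
    let ?d = "if idle M h i t then 0 else ?q" and ?d' = "if idle M h' i t then 0 else ?q"
    have "(unc h i has_real_derivative ?d) (at_right t)"
      using assms(1) t unfolding uncertainty_dynamics_def by simp
    moreover have "(unc h' i has_real_derivative ?d') (at_right t)"
      using assms(2) t unfolding uncertainty_dynamics_def jd by simp
    ultimately have
      "(f has_real_derivative 2 * (unc h i t - unc h' i t) * (?d - ?d')) (at_right t)"
      unfolding f_def by (auto intro!: derivative_eq_intros simp del: if_split)
    moreover have "2 * (unc h i t - unc h' i t) * (?d - ?d') \<le> 0"
    proof -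
      have "0 \<le> unc h i t" "0 \<le> unc h' i t"
        using assms(1,2) t by (auto simp: uncertainty_dynamics_def)
      then show ?thesis
        by (auto simp: idle_def jd mult_le_0_iff)
    qed
    ultimately show "\<exists>d\<le>0. (f has_real_derivative d) (at_right t)" by blast
  qed (use assms(4) in auto)
  moreover have "f 0 = 0" using assms(1,2) by (simp add: f_def uncertainty_dynamics_def)
  ultimately show ?thesis by (simp add: f_def)
qed

text \<open>Uncertainties are compared on the horizon only, because the dynamics leave them free
  elsewhere; the parameters fix positions and controls at all times.\<close>

definition same_on_horizon ::
  "('n::finite, 'm) model \<Rightarrow> ('n, 'm) run \<Rightarrow> ('n, 'm) run \<Rightarrow> bool" where
  "same_on_horizon M h h' \<longleftrightarrow>
     pos h = pos h' \<and> ctrl h = ctrl h' \<and> (\<forall>t\<in>{0..horizon M}. \<forall>i. unc h i t = unc h' i t)"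

lemma same_on_horizon_sym: "same_on_horizon M h h' \<Longrightarrow> same_on_horizon M h' h"
  by (simp add: same_on_horizon_def)

lemma idle_same:
  assumes "same_on_horizon M h h'" "t \<in> {0..horizon M}"
  shows "idle M h i t = idle M h' i t"
  using assms by (simp add: same_on_horizon_def idle_def joint_detect_def)

lemma co_observers_same:
  "same_on_horizon M h h' \<Longrightarrow> co_observers M h i j t = co_observers M h' i j t"
  by (simp add: same_on_horizon_def co_observers_def agent_nbhd_def)

text \<open>Only type I events look at the uncertainty, so only for them must the one-sided
  neighbourhood of \<open>t\<close> be kept inside the horizon.\<close>

lemma occurs_same_imp:
  assumes same: "same_on_horizon M h h'" and occ: "occurs M h e t"
  shows "occurs M h' e t"
proof (cases e)
  case (Rho0 i)
  then have t: "0 < t" "t \<le> horizon M" using occ by auto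
  then have "\<forall>\<^sub>F \<tau> in at_left t. idle M h i \<tau> = idle M h' i \<tau>"
    unfolding eventually_at_left_field using idle_same[OF same] by (intro exI[of _ 0]) auto
  then have "(\<forall>\<^sub>F \<tau> in at_left t. \<not> idle M h i \<tau>) \<longleftrightarrow> (\<forall>\<^sub>F \<tau> in at_left t. \<not> idle M h' i \<tau>)"
    by (intro eventually_cong) (auto elim: eventually_mono)
  then show ?thesis using occ t Rho0 idle_same[OF same, of t i] by auto
next
  case (RhoPlus i)
  then have t: "0 \<le> t" "t < horizon M" using occ by auto
  then have "\<forall>\<^sub>F \<tau> in at_right t. idle M h i \<tau> = idle M h' i \<tau>"
    unfolding eventually_at_right_field using idle_same[OF same]
    by (intro exI[of _ "horizon M"]) auto
  then have "(\<forall>\<^sub>F \<tau> in at_right t. \<not> idle M h i \<tau>) \<longleftrightarrow> (\<forall>\<^sub>F \<tau> in at_right t. \<not> idle M h' i \<tau>)"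
    by (intro eventually_cong) (auto elim: eventually_mono)
  then show ?thesis using occ t RhoPlus idle_same[OF same, of t i] by auto
qed (use same occ co_observers_same[OF same] in \<open>auto simp: same_on_horizon_def\<close>)

lemma occurs_same:
  assumes "same_on_horizon M h h'"
  shows "occurs M h = occurs M h'"
  using occurs_same_imp[OF assms] occurs_same_imp[OF same_on_horizon_sym[OF assms]] by blast

lemma event_times_same:
  assumes "same_on_horizon M h h'"
  shows "event_times M h = event_times M h'"
  unfolding event_times_def occurs_same[OF assms] ..

lemma generated_run_same:
  assumes "generated_run M lay s0 R0 v h" "generated_run M lay s0 R0 v' h'"
    and "\<And>j c. c \<in> coords (lay j) \<Longrightarrow> v' j c = v j c"
  shows "same_on_horizon M h h'"
proof -
  have "plan (lay j) (v' j) = plan (lay j) (v j)" for j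
    using assms(3) by (rule plan_cong)
  then have "pos h = pos h'" "ctrl h = ctrl h'"
    using assms(1,2) by (auto simp: generated_run_def)
  then show ?thesis
    using assms(1,2) unc_unique[of M R0 h h']
    unfolding same_on_horizon_def generated_run_def by blast
qed

lemma position_gradient_same:
  assumes same: "same_on_horizon M h h'"
    and v: "\<And>c. c \<in> coords ds \<Longrightarrow> v' c = v c"
    and "position_gradient M ds y v h j D"
  shows "position_gradient M ds y v' h' j D"
proof -
  have "plan ds (v'(c := z)) = plan ds (v(c := z))" for c z
    using v by (intro plan_cong) auto
  then show ?thesis
    using assms(3) v unfolding position_gradient_def occurs_same[OF same] by simp
qed

lemma uncertainty_gradient_same:
  assumes same: "same_on_horizon M h h'" and "uncertainty_gradient M h j i ds dR"
  shows "uncertainty_gradient M h' j i ds dR"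
proof -
  have "pos h = pos h'" using same by (simp add: same_on_horizon_def)
  then have "(\<forall>t\<in>{0<..<horizon M} - event_times M h' - K.
      (dR has_real_derivative
        (if idle M h i t then 0
         else - decay M i * detect_slope M i j (pos h j t) * ds t *
           (\<Prod>g\<in>co_observers M h' i j t. 1 - detect M i (pos h g t)))) (at t)) \<longleftrightarrow>
    (\<forall>t\<in>{0<..<horizon M} - event_times M h' - K.
      (dR has_real_derivative
        (if idle M h' i t then 0
         else - decay M i * detect_slope M i j (pos h' j t) * ds t *
           (\<Prod>g\<in>co_observers M h' i j t. 1 - detect M i (pos h' g t)))) (at t))" for K
    using idle_same[OF same] by (intro ball_cong) simp_all
  then show ?thesis
    using assms(2)
    unfolding uncertainty_gradient_def event_times_same[OF same] occurs_same[OF same]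
      co_observers_same[OF same]
    by metis
qed

lemma ipa_gradient_same:
  assumes "same_on_horizon M h h'" "\<And>c. c \<in> coords ds \<Longrightarrow> v' c = v c"
    and "ipa_gradient M ds y v h j g"
  shows "ipa_gradient M ds y v' h' j g"
proof -
  obtain D dR where "position_gradient M ds y v h j D"
    and dR: "\<forall>c\<in>coords ds. (\<forall>i. uncertainty_gradient M h j i (D c) (dR i c)) \<and>
      g c = 1 / horizon M * (\<Sum>i\<in>UNIV. integral {0..horizon M} (dR i c))"
    using assms(3) unfolding ipa_gradient_def by blast
  then have "position_gradient M ds y v' h' j D"
    by (intro position_gradient_same[OF assms(1,2)])
  then show ?thesis
    unfolding ipa_gradient_def using dR uncertainty_gradient_same[OF assms(1)]
    by (intro exI[of _ D] exI[of _ dR]) blast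
qed

section \<open>The local information determines the gradient\<close>

lemma detect_pos_imp_target_nbhd:
  assumes "valid_model M" "0 < detect M i (pos h j t)"
  shows "i \<in> target_nbhd M h j t"
  using assms by (auto simp: valid_model_def detect_def target_nbhd_def field_simps max_def split: if_splits)

lemma detect_eq_0_outside:
  assumes "valid_model M" "k \<notin> agent_nbhd M h i t"
  shows "detect M i (pos h k t) = 0"
  using assms by (auto simp: valid_model_def detect_def agent_nbhd_def field_simps max_def abs_minus_commute)

text \<open>Agents out of range contribute a factor 1. The factor of \<open>j\<close> is split off
  whether or not \<open>j\<close> is in range.\<close>

lemma joint_detect_co_observers:
  assumes "valid_model M"
  shows "joint_detect M h i t =
    1 - (1 - detect M i (pos h j t)) * (\<Prod>g\<in>co_observers M h i j t. 1 - detect M i (pos h g t))"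
proof -
  have "(\<Prod>g\<in>UNIV. 1 - detect M i (pos h g t)) =
      (\<Prod>g\<in>insert j (co_observers M h i j t). 1 - detect M i (pos h g t))"
    by (rule prod.mono_neutral_right) (auto simp: co_observers_def intro!: detect_eq_0_outside assms)
  moreover have "j \<notin> co_observers M h i j t" by (simp add: co_observers_def)
  ultimately show ?thesis by (simp add: joint_detect_def)
qed

text \<open>By the triangle inequality through the target, two observers of it are at distance at
  most \<open>2 * sense_rad M\<close>.\<close>

lemma co_observers_subset_partners:
  assumes "valid_model M" "i \<in> target_nbhd M h j t"
  shows "co_observers M h i j t \<subseteq> partners M h j t"
  using assms
  by (force simp: valid_model_def partners_def co_observers_def comm_nbhd_def agent_nbhd_def
      target_nbhd_def)

section \<open>Two runs that agent \<open>j\<close> cannot tell apart\<close>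

context
  fixes M :: "('n::finite, 'm::finite) model"
    and lay1 lay2 :: "'n \<Rightarrow> layout" and v1 v2 :: "'n \<Rightarrow> params"
    and h1 h2 :: "('n, 'm) run" and j :: 'n
  assumes valid: "valid_model M"
    and info: "info_of M lay1 v1 h1 j = info_of M lay2 v2 h2 j"
begin

lemma info_pos_eq: "t \<in> {0..horizon M} \<Longrightarrow> pos h1 j t = pos h2 j t"
  using fun_cong[of _ _ t, OF arg_cong[OF info, of own_traj]]
  by (simp add: info_of_def during_def)

lemma info_observation_eq:
  "t \<in> {0..horizon M} \<Longrightarrow> observation M h1 j t = observation M h2 j t"
  using fun_cong[of _ _ t, OF arg_cong[OF info, of own_obs]]
  by (simp add: info_of_def during_def)

lemma info_partners_eq:
  assumes "t \<in> {0..horizon M}"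
  shows "partners M h1 j t = partners M h2 j t"
    and "k \<in> partners M h1 j t \<Longrightarrow> pos h1 k t = pos h2 k t"
proof -
  \<comment> \<open>Whether a message from \<open>k\<close> arrives reveals if \<open>k\<close> is a
    partner, and its first entry is the position.\<close>
  have *: "(if k \<in> partners M h1 j t then Some (pos h1 k t, ctrl h1 k t, observation M h1 k t) else None)
    = (if k \<in> partners M h2 j t then Some (pos h2 k t, ctrl h2 k t, observation M h2 k t) else None)" for k
    using fun_cong[of _ _ t, OF arg_cong[OF info, of received]] assms
    by (simp add: info_of_def during_def fun_eq_iff)
  show "partners M h1 j t = partners M h2 j t"
    using * by (auto split: if_splits) (metis option.distinct(1))+
  then show "k \<in> partners M h1 j t \<Longrightarrow> pos h1 k t = pos h2 k t"
    using *[of k] by simp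
qed

lemma info_target_nbhd_eq:
  "t \<in> {0..horizon M} \<Longrightarrow> target_nbhd M h1 j t = target_nbhd M h2 j t"
  by (simp add: target_nbhd_def info_pos_eq)

text \<open>In both runs the co-observers are among the common partners, whose positions are known,
  and position decides membership.\<close>

lemma info_co_observers_eq:
  assumes t: "t \<in> {0..horizon M}" and i: "i \<in> target_nbhd M h1 j t"
  shows "co_observers M h1 i j t = co_observers M h2 i j t"
proof -
  have sub: "co_observers M h1 i j t \<subseteq> partners M h1 j t"
    using co_observers_subset_partners[OF valid i] .
  have "i \<in> target_nbhd M h2 j t" using i info_target_nbhd_eq[OF t] by simp
  from co_observers_subset_partners[OF valid this]
  have "co_observers M h2 i j t \<subseteq> partners M h1 j t"
    using info_partners_eq(1)[OF t] by simp
  then show ?thesis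
    using sub info_partners_eq(2)[OF t] unfolding co_observers_def agent_nbhd_def by fastforce
qed

lemma info_co_detect_eq:
  assumes t: "t \<in> {0..horizon M}" and i: "i \<in> target_nbhd M h1 j t"
  shows "(\<Prod>g\<in>co_observers M h1 i j t. 1 - detect M i (pos h1 g t)) =
    (\<Prod>g\<in>co_observers M h2 i j t. 1 - detect M i (pos h2 g t))"
  using info_partners_eq(2)[OF t] co_observers_subset_partners[OF valid i]
  by (intro prod.cong info_co_observers_eq[OF t i]) (auto simp: info_co_observers_eq[OF t i])

text \<open>Positive detection acts twice: it makes the uncertainty observable, and it puts
  \<open>i\<close> in the target neighborhood, where the other factors of the joint detection are
  known.\<close>

lemma info_idle_eq:
  assumes t: "t \<in> {0..horizon M}" and d: "0 < detect M i (pos h1 j t)"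
  shows "idle M h1 i t = idle M h2 i t"
proof -
  have "joint_detect M h1 i t = joint_detect M h2 i t"
    using info_co_detect_eq[OF t detect_pos_imp_target_nbhd[OF valid d]]
    by (simp add: joint_detect_co_observers[OF valid, of _ _ _ j] info_pos_eq[OF t])
  moreover have "unc h1 i t = unc h2 i t"
    using fun_cong[OF info_observation_eq[OF t], of i] d info_pos_eq[OF t]
    by (simp add: observation_def)
  ultimately show ?thesis by (simp add: idle_def)
qed

text \<open>Here the nonlocal information enters. A hit of a target in the neighborhood is among the
  known events, any other is among the remote hits, and none occurs outside the horizon.\<close>

lemma info_Rho0_eq: "occurs M h1 (Rho0 i) t = occurs M h2 (Rho0 i) t"
proof (cases "t \<in> {0..horizon M}")
  case t: True
  show ?thesis
  proof (cases "i \<in> target_nbhd M h1 j t")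
    case i: True
    have "Rho0 i \<in> local_info M h j t" if "i \<in> target_nbhd M h j t" for h :: "('n, 'm) run"
      using that by (auto simp: local_info_def local_events_def target_events_def)
    then have "Rho0 i \<in> local_info M h1 j t" "Rho0 i \<in> local_info M h2 j t"
      using i info_target_nbhd_eq[OF t] by simp_all
    moreover have "(t, Rho0 i) \<in> known_events (info_of M lay1 v1 h1 j) \<longleftrightarrow>
        (t, Rho0 i) \<in> known_events (info_of M lay2 v2 h2 j)"
      using info by simp
    ultimately show ?thesis using t by (simp add: info_of_def)
  next
    case i: False
    have "(t, Rho0 i) \<in> remote_hits (info_of M lay1 v1 h1 j) \<longleftrightarrow>
        (t, Rho0 i) \<in> remote_hits (info_of M lay2 v2 h2 j)"
      using info by simp
    then show ?thesis using t i info_target_nbhd_eq[OF t] by (simp add: info_of_def)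
  qed
qed auto

lemma info_uncertainty_gradient_eq:
  assumes fin: "finite (event_times M h1)" "finite (event_times M h2)"
    and ds: "\<And>t. t \<in> {0..<horizon M} \<Longrightarrow> ds1 t = ds2 t"
    and g1: "uncertainty_gradient M h1 j i ds1 dR1"
    and g2: "uncertainty_gradient M h2 j i ds2 dR2"
    and t: "t \<in> {0..horizon M}"
  shows "dR1 t = dR2 t"
proof -
  let ?rate = "\<lambda>h ds t. if idle M h i t then 0
    else - decay M i * detect_slope M i j (pos h j t) * ds t *
      (\<Prod>g\<in>co_observers M h i j t. 1 - detect M i (pos h g t))"
  obtain K1 where K1: "finite K1"
    "\<And>t. t \<in> {0<..<horizon M} - event_times M h1 - K1 \<Longrightarrow> (dR1 has_real_derivative ?rate h1 ds1 t) (at t)"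
    using g1 unfolding uncertainty_gradient_def by blast
  obtain K2 where K2: "finite K2"
    "\<And>t. t \<in> {0<..<horizon M} - event_times M h2 - K2 \<Longrightarrow> (dR2 has_real_derivative ?rate h2 ds2 t) (at t)"
    using g2 unfolding uncertainty_gradient_def by blast
  have rate: "?rate h1 ds1 t = ?rate h2 ds2 t" if "t \<in> {0<..<horizon M}" for t
  proof -
    have t: "t \<in> {0..horizon M}" "ds1 t = ds2 t" using that ds by auto
    show ?thesis
    proof (cases "0 < detect M i (pos h1 j t)")
      case True
      then show ?thesis
        using info_idle_eq[OF t(1) True] t(2) info_pos_eq[OF t(1)]
          info_co_detect_eq[OF t(1) detect_pos_imp_target_nbhd[OF valid True]] by simp
    next
      \<comment> \<open>The two runs may disagree on \<open>idle\<close> and on the co-observers,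
        but both branches of the rate are 0.\<close>
      case False
      moreover have "0 \<le> detect M i (pos h1 j t)" by (simp add: detect_def)
      ultimately have "detect_slope M i j (pos h1 j t) = 0" by (simp add: detect_slope_def)
      then show ?thesis using info_pos_eq[OF t(1)] by simp
    qed
  qed
  have reset1: "if occurs M h1 (Rho0 i) t then dR1 t = 0 else continuous (at_left t) dR1"
    if "t \<in> {0<..horizon M}" for t
    using g1 that unfolding uncertainty_gradient_def by blast
  \<comment> \<open>Expressing the resets of \<open>dR2\<close> by occurrences in \<open>h1\<close>
    shows that both functions are reset at the same instants.\<close>
  have reset2: "if occurs M h1 (Rho0 i) t then dR2 t = 0 else continuous (at_left t) dR2"
    if "t \<in> {0<..horizon M}" for t
    using g2 that unfolding uncertainty_gradient_def info_Rho0_eq by blast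
  have "dR1 t - dR2 t = 0"
  proof (rule zero_of_piecewise_constant[where f = "\<lambda>t. dR1 t - dR2 t" and a = 0 and b = "horizon M"])
    \<comment> \<open>Events hidden from \<open>j\<close> may differ between the runs, so the
      exceptional instants of both are collected.\<close>
    show "finite (event_times M h1 \<union> event_times M h2 \<union> K1 \<union> K2)" using fin K1(1) K2(1) by simp
    show "dR1 0 - dR2 0 = 0" using g1 g2 by (simp add: uncertainty_gradient_def)
    fix t
    show "((\<lambda>t. dR1 t - dR2 t) has_real_derivative 0) (at t)"
      if "t \<in> {0<..<horizon M} - (event_times M h1 \<union> event_times M h2 \<union> K1 \<union> K2)"
    proof -
      have "((\<lambda>t. dR1 t - dR2 t) has_real_derivative ?rate h1 ds1 t - ?rate h2 ds2 t) (at t)"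
        using that by (intro DERIV_diff K1(2) K2(2)) auto
      moreover have "?rate h1 ds1 t - ?rate h2 ds2 t = 0"
        using that by (intro right_minus_eq[THEN iffD2] rate) auto
      ultimately show ?thesis by (simp only:)
    qed
    show "continuous (at_right t) (\<lambda>t. dR1 t - dR2 t)" if "t \<in> {0..<horizon M}"
      using g1 g2 that by (intro continuous_intros) (auto simp: uncertainty_gradient_def)
    show "dR1 t - dR2 t = 0 \<or> continuous (at_left t) (\<lambda>t. dR1 t - dR2 t)"
      if "t \<in> {0<..horizon M}"
    proof (cases "occurs M h1 (Rho0 i) t")
      case True
      then have "dR1 t = 0" "dR2 t = 0"
        using reset1[OF that] reset2[OF that] by (simp_all only: if_True)
      then show ?thesis by simp
    next
      case False
      then have "continuous (at_left t) dR1" "continuous (at_left t) dR2"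
        using reset1[OF that] reset2[OF that] by (simp_all only: if_False)
      then show ?thesis by (intro disjI2 continuous_diff)
    qed
  qed fact
  then show ?thesis by simp
qed

end

section \<open>Uniqueness of the gradient for given information\<close>

text \<open>Away from events both functions are the same partial derivative. These instants
  accumulate at every \<open>t\<close> from the right, so right continuity settles the remaining
  ones.\<close>

lemma position_gradient_unique:
  assumes valid: "valid_model M"
    and feasible: "\<And>c. c \<in> coords ds \<Longrightarrow> v1 c \<in> feasible_values M c"
    and v: "\<And>c. c \<in> coords ds \<Longrightarrow> v2 c = v1 c"
    and ctrl: "ctrl h2 j = ctrl h1 j"
    and fin: "finite (event_times M h1)"
    and g1: "position_gradient M ds y v1 h1 j D1" and g2: "position_gradient M ds y v2 h2 j D2"
    and c: "c \<in> coords ds" and t: "t \<in> {0..<horizon M}"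
  shows "D1 c t = D2 c t"
proof -
  let ?P = "\<lambda>z. position y (plan ds (v1(c := z)))"
  have plan: "plan ds (v2(c := z)) = plan ds (v1(c := z))" for z
    using v by (intro plan_cong) auto
  have Nu: "occurs M h2 (Nu j a b) s = occurs M h1 (Nu j a b) s" for a b s
    using ctrl by simp
  have regular: "D1 c s = D2 c s" if s: "s \<in> {0<..<horizon M} - event_times M h1" for s
  proof (rule has_real_derivative_unique_within)
    have no: "\<not> occurs M h1 (Nu j a b) s" for a b
      using s unfolding event_times_def by (metis DiffE mem_Collect_eq)
    show "((\<lambda>z. ?P z s) has_real_derivative D1 c s) (at (v1 c) within feasible_values M c)"
      using g1[unfolded position_gradient_def, THEN bspec, OF c, THEN conjunct1, rule_format, of s]
        s no by simp
    show "((\<lambda>z. ?P z s) has_real_derivative D2 c s) (at (v1 c) within feasible_values M c)"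
      using g2[unfolded position_gradient_def, THEN bspec, OF c, THEN conjunct1, rule_format, of s]
        s no unfolding plan Nu v[OF c] by simp
    show "at (v1 c) within feasible_values M c \<noteq> bot"
      using feasible_values_at_within[OF valid feasible[OF c]] .
  qed
  have "\<forall>\<^sub>F s in at_right t. s \<notin> event_times M h1"
    using fin by (rule eventually_at_right_notin_finite)
  moreover have "\<forall>\<^sub>F s in at_right t. s \<in> {0<..<horizon M}"
    unfolding eventually_at_right_field using t by (intro exI[of _ "horizon M"]) auto
  ultimately have ev: "\<forall>\<^sub>F s in at_right t. D1 c s = D2 c s"
    by eventually_elim (use regular in auto)
  have "(D1 c \<longlongrightarrow> D1 c t) (at_right t)" "(D2 c \<longlongrightarrow> D2 c t) (at_right t)"
    using g1[unfolded position_gradient_def, THEN bspec, OF c, THEN conjunct2, THEN conjunct2]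
      g2[unfolded position_gradient_def, THEN bspec, OF c, THEN conjunct2, THEN conjunct2] t
    by (simp_all add: continuous_within)
  then have "(D2 c \<longlongrightarrow> D1 c t) (at_right t)" "(D2 c \<longlongrightarrow> D2 c t) (at_right t)"
    using tendsto_cong[OF ev] by simp_all
  then show ?thesis by (rule tendsto_unique[OF trivial_limit_at_right_real])
qed

text \<open>Nothing is assumed equal except the information of \<open>j\<close>: layouts,
  parameters, initial positions and initial uncertainties may all differ. What concerns
  \<open>j\<close> itself is recovered first.\<close>

lemma ipa_gradient_determined:
  assumes valid: "valid_model M"
    and info: "info_of M lay1 v1 h1 j = info_of M lay2 v2 h2 j"
    and run1: "admissible_run M lay1 s1 R1 v1 h1" and run2: "admissible_run M lay2 s2 R2 v2 h2"
    and g1: "ipa_gradient M (lay1 j) (s1 j) (v1 j) h1 j g1"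
    and g2: "ipa_gradient M (lay2 j) (s2 j) (v2 j) h2 j g2"
    and c: "c \<in> coords (lay1 j)"
  shows "g1 c = g2 c"
proof -
  have T: "0 \<in> {0..horizon M}" using valid by (simp add: valid_model_def)
  have lay: "lay2 j = lay1 j" using arg_cong[OF info, of own_layout] by (simp add: info_of_def)
  have plan: "plan (lay2 j) (v2 j) = plan (lay1 j) (v1 j)"
    using arg_cong[OF info, of own_plan] by (simp add: info_of_def)
  have feasible1: "v1 j c \<in> feasible_values M c" if "c \<in> coords (lay1 j)" for c
    using run1 that by (simp add: admissible_run_def)
  have feasible2: "v2 j c \<in> feasible_values M c" if "c \<in> coords (lay2 j)" for c
    using run2 that by (simp add: admissible_run_def)
  have pos1: "pos h1 j = position (s1 j) (plan (lay1 j) (v1 j))"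
    and ctrl1: "ctrl h1 j = control (s1 j) (plan (lay1 j) (v1 j))"
    using run1 by (auto simp: admissible_run_def generated_run_def)
  have pos2: "pos h2 j = position (s2 j) (plan (lay2 j) (v2 j))"
    and ctrl2: "ctrl h2 j = control (s2 j) (plan (lay2 j) (v2 j))"
    using run2 by (auto simp: admissible_run_def generated_run_def)
  \<comment> \<open>Both plans have nonnegative dwell times, so the observed position at time 0 is
    the starting point.\<close>
  have s: "s2 j = s1 j"
    using info_pos_eq[OF valid info T] position_plan_0[OF feasible1] position_plan_0[OF feasible2]
    unfolding pos1 pos2 by simp
  have v: "v2 j c = v1 j c" if "c \<in> coords (lay1 j)" for c
    using plan_eqD plan lay that by metis
  have ctrl: "ctrl h2 j = ctrl h1 j" using ctrl1 ctrl2 s plan by simp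
  have fin: "finite (event_times M h1)" "finite (event_times M h2)"
    using run1 run2 by (auto simp: admissible_run_def)
  obtain D1 dR1 where D1: "position_gradient M (lay1 j) (s1 j) (v1 j) h1 j D1"
    and dR1: "\<And>i. uncertainty_gradient M h1 j i (D1 c) (dR1 i c)"
    and g1: "g1 c = 1 / horizon M * (\<Sum>i\<in>UNIV. integral {0..horizon M} (dR1 i c))"
    using g1 c unfolding ipa_gradient_def by blast
  obtain D2 dR2 where D2: "position_gradient M (lay1 j) (s1 j) (v2 j) h2 j D2"
    and dR2: "\<And>i. uncertainty_gradient M h2 j i (D2 c) (dR2 i c)"
    and g2: "g2 c = 1 / horizon M * (\<Sum>i\<in>UNIV. integral {0..horizon M} (dR2 i c))"
    using g2 c unfolding ipa_gradient_def lay s by blast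
  \<comment> \<open>The end of the horizon is left out, since \<open>position_gradient\<close> does
    not constrain \<open>D\<close> there.\<close>
  have "D1 c t = D2 c t" if "t \<in> {0..<horizon M}" for t
    using position_gradient_unique[OF valid feasible1 v ctrl fin(1) D1 D2 c that] .
  then have "dR1 i c t = dR2 i c t" if "t \<in> {0..horizon M}" for i t
    using info_uncertainty_gradient_eq[OF valid info fin _ dR1 dR2 that] by blast
  then have "integral {0..horizon M} (dR1 i c) = integral {0..horizon M} (dR2 i c)" for i
    by (intro integral_cong)
  then show ?thesis using g1 g2 by simp
qed

section \<open>The evaluation rule and the comparison of the two schemes\<close>

lemma ipa_gradient_cong:
  assumes "ipa_gradient M ds y v h j g" "\<And>c. c \<in> coords ds \<Longrightarrow> g' c = g c"
  shows "ipa_gradient M ds y v h j g'"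
proof -
  obtain D dR where "position_gradient M ds y v h j D"
    "\<forall>c\<in>coords ds. (\<forall>i. uncertainty_gradient M h j i (D c) (dR i c)) \<and>
       g c = 1 / horizon M * (\<Sum>i\<in>UNIV. integral {0..horizon M} (dR i c))"
    using assms(1) unfolding ipa_gradient_def by blast
  then show ?thesis
    unfolding ipa_gradient_def using assms(2) by (intro exI[of _ D] exI[of _ dR]) simp
qed

text \<open>Layouts, parameters and runs are bound inside the choice, so the result depends on the
  actual run only through \<open>I\<close>. The choice is over all admissible runs compatible with
  \<open>I\<close>.\<close>

definition gradient_rule ::
  "('n::finite, 'm::finite) model \<Rightarrow> 'n \<Rightarrow> ('n, 'm) info \<Rightarrow> coord \<Rightarrow> real" where
  "gradient_rule M j I = (SOME g. \<exists>lay s0 R0 v h. admissible_run M lay s0 R0 v h \<and>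
     info_of M lay v h j = I \<and> ipa_gradient M (lay j) (s0 j) (v j) h j g)"

text \<open>The actual run witnesses that the choice is not void. The run behind the chosen value
  may be another one, but \<open>j\<close> cannot distinguish it, so the gradients agree.\<close>

lemma gradient_rule_eq:
  assumes "valid_model M" "admissible_run M lay s0 R0 v h"
    and "ipa_gradient M (lay j) (s0 j) (v j) h j g" "c \<in> coords (lay j)"
  shows "gradient_rule M j (info_of M lay v h j) c = g c"
proof -
  have "\<exists>g lay' s0' R0' v' h'. admissible_run M lay' s0' R0' v' h' \<and>
      info_of M lay' v' h' j = info_of M lay v h j \<and> ipa_gradient M (lay' j) (s0' j) (v' j) h' j g"
    using assms(2,3) by blast
  from someI_ex[OF this] obtain lay' s0' R0' v' h' where
    "admissible_run M lay' s0' R0' v' h'" "info_of M lay' v' h' j = info_of M lay v h j"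
    "ipa_gradient M (lay' j) (s0' j) (v' j) h' j (gradient_rule M j (info_of M lay v h j))"
    unfolding gradient_rule_def by blast
  with ipa_gradient_determined[OF assms(1) _ assms(2) _ assms(3) _ assms(4)] show ?thesis
    by metis
qed

theorem theorem1:
  fixes M :: "('n::finite, 'm::finite) model"
  assumes "valid_model M"
  shows "\<exists>G :: 'n \<Rightarrow> ('n, 'm) info \<Rightarrow> coord \<Rightarrow> real.
    \<forall>(lay :: 'n \<Rightarrow> layout) s0 R0 \<alpha>\<theta> \<alpha>w v h.
      valid_init M s0 R0 \<longrightarrow> step_sizes \<alpha>\<theta> \<longrightarrow> step_sizes \<alpha>w \<longrightarrow>
      centralized_solution M lay s0 R0 \<alpha>\<theta> \<alpha>w v h \<longrightarrow>
        (\<exists>v' h'. decentralized_solution M G lay s0 R0 \<alpha>\<theta> \<alpha>w (v 0) v' h') \<and>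
        (\<forall>v' h'. decentralized_solution M G lay s0 R0 \<alpha>\<theta> \<alpha>w (v 0) v' h' \<longrightarrow>
           (\<forall>l j. ipa_gradient M (lay j) (s0 j) (v' l j) (h' l) j (G j (info_of M lay (v' l) (h' l) j)) \<and>
                  (\<forall>c\<in>coords (lay j). v' l j c = v l j c)))"
proof (intro exI[of _ "gradient_rule M"] allI impI conjI)
  fix lay :: "'n \<Rightarrow> layout" and s0 R0 \<alpha>\<theta> \<alpha>w v h
  assume "centralized_solution M lay s0 R0 \<alpha>\<theta> \<alpha>w v h"
  then have run: "admissible_run M lay s0 R0 (v l) (h l)"
    and "\<exists>grad. \<forall>j. ipa_gradient M (lay j) (s0 j) (v l j) (h l) j (grad j) \<and>
      (\<forall>c\<in>coords (lay j). v (Suc l) j c = v l j c - step \<alpha>\<theta> \<alpha>w l c * grad j c)" for l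
    unfolding centralized_solution_def by blast+
  then obtain grad where
    grad: "\<And>l j. ipa_gradient M (lay j) (s0 j) (v l j) (h l) j (grad l j)"
    and upd: "\<And>l j c. c \<in> coords (lay j) \<Longrightarrow>
      v (Suc l) j c = v l j c - step \<alpha>\<theta> \<alpha>w l c * grad l j c"
    by metis
  \<comment> \<open>The centralized solution itself serves as witness.\<close>
  show "\<exists>v' h'. decentralized_solution M (gradient_rule M) lay s0 R0 \<alpha>\<theta> \<alpha>w (v 0) v' h'"
    using gradient_rule_eq[OF assms run grad] run upd
    by (intro exI[of _ v] exI[of _ h])
      (auto simp: decentralized_solution_def admissible_run_def)
  fix v' h'
  assume "decentralized_solution M (gradient_rule M) lay s0 R0 \<alpha>\<theta> \<alpha>w (v 0) v' h'"
  then have init': "\<And>j c. c \<in> coords (lay j) \<Longrightarrow> v' 0 j c = v 0 j c"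
    and run': "\<And>l. generated_run M lay s0 R0 (v' l) (h' l)"
    and upd': "\<And>l j c. c \<in> coords (lay j) \<Longrightarrow> v' (Suc l) j c =
      v' l j c - step \<alpha>\<theta> \<alpha>w l c * gradient_rule M j (info_of M lay (v' l) (h' l) j) c"
    unfolding decentralized_solution_def by blast+
  have transfer: "ipa_gradient M (lay j) (s0 j) (v' l j) (h' l) j (grad l j)"
    "\<And>c. c \<in> coords (lay j) \<Longrightarrow>
      gradient_rule M j (info_of M lay (v' l) (h' l) j) c = grad l j c"
    if eq: "\<And>j c. c \<in> coords (lay j) \<Longrightarrow> v' l j c = v l j c" for l j
  proof -
    have same: "same_on_horizon M (h l) (h' l)"
      using run[of l, unfolded admissible_run_def] run'[of l] eq
      by (intro generated_run_same[of M lay s0 R0 "v l" "h l" "v' l"]) auto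
    show g: "ipa_gradient M (lay j) (s0 j) (v' l j) (h' l) j (grad l j)"
      using ipa_gradient_same[OF same eq grad] .
    \<comment> \<open>A decentralized solution is only required to be a generated run; feasibility
      and finitely many events are inherited from the centralized run.\<close>
    have adm: "admissible_run M lay s0 R0 (v' l) (h' l)"
      using run[of l] run'[of l] eq unfolding admissible_run_def event_times_same[OF same]
      by auto
    show "gradient_rule M j (info_of M lay (v' l) (h' l) j) c = grad l j c"
      if "c \<in> coords (lay j)" for c
      using gradient_rule_eq[OF assms adm g that] .
  qed
  \<comment> \<open>The induction covers all agents at once, because the run in which
    \<open>j\<close> collects its information depends on the parameters of every agent.\<close>
  have eq: "v' l j c = v l j c" if "c \<in> coords (lay j)" for l j c
    using that
  proof (induction l arbitrary: j c)
    case 0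
    then show ?case by (rule init')
  next
    case (Suc l)
    then show ?case using transfer(2)[of l, OF Suc.IH] upd upd' by simp
  qed
  fix l j
  \<comment> \<open>The output of the rule agrees with \<open>grad l j\<close> only on the
    coordinates of the layout, which is all that \<open>ipa_gradient\<close> inspects.\<close>
  show "ipa_gradient M (lay j) (s0 j) (v' l j) (h' l) j
      (gradient_rule M j (info_of M lay (v' l) (h' l) j))"
    using transfer[of l, OF eq] by (rule ipa_gradient_cong)
  show "\<forall>c\<in>coords (lay j). v' l j c = v l j c" using eq by simp
qed

end
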